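(* Let $A,B,C,D\in\mathbb{C}^{n\times n}$ be such that $A$, $D$, $BC$ and $CB$ are *-DMP, and let $M=\begin{pmatrix}A&B\\ C&D\end{pmatrix}\in\mathbb{C}^{2n\times 2n}$. If $AB=BD$, $DC=CA$, $B^*A=DB^*$ and $A^DBD^DC$ is nilpotent, then $M$ is *-DMP.
   Context: $\mathbb{C}^{k\times k}$ is the Banach *-algebra of $k\times k$ complex matrices with conjugate transpose $X^*$ as involution. The Drazin inverse $X^D$ of a matrix $X$ is the unique matrix $Y$ with $YX^{k+1}=X^k$ for some $k$, $XY^2=Y$, $XY=YX$ (the superscript $D$ denotes the Drazin inverse, not the block $D$). A matrix $X$ is *-DMP if there is a positive integer $r$ such that $X^r$ has a Moore-Penrose inverse and a group inverse and $(X^r)^{\dag}=(X^r)^{\#}$ (here $Z^{\dag}$ is the $Y$ with $ZYZ=Z$, $YZY=Y$, $(ZY)^*=ZY$, $(YZ)^*=YZ$, and $Z^{\#}$ is the $Y$ with $ZYZ=Z$, $YZY=Y$, $ZY=YZ$). *)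

theory Defs
  imports Complex_Main "Jordan_Normal_Form.Schur_Decomposition"
begin

text \<open>
  The \<open>n \<times> n\<close> complex matrices are the elements of \<^term>\<open>carrier_mat n n :: complex mat set\<close>;
  the conjugate transpose is the library function \<^term>\<open>mat_adjoint\<close>.
  The inverses below are defined by a definite description. The uniqueness lemmas justify this
  whenever an inverse exists; otherwise the value is unspecified.
\<close>

definition is_drazin_inverse :: "complex mat \<Rightarrow> complex mat \<Rightarrow> bool" where
  "is_drazin_inverse X Y \<longleftrightarrow>
     square_mat X \<and> Y \<in> carrier_mat (dim_row X) (dim_row X) \<and>
     (\<exists>k. Y * X ^\<^sub>m (k + 1) = X ^\<^sub>m k) \<and> X * (Y * Y) = Y \<and> X * Y = Y * X"

definition drazin_inverse :: "complex mat \<Rightarrow> complex mat" where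
  "drazin_inverse X = (THE Y. is_drazin_inverse X Y)"

definition is_moore_penrose_inverse :: "complex mat \<Rightarrow> complex mat \<Rightarrow> bool" where
  "is_moore_penrose_inverse Z Y \<longleftrightarrow>
     Y \<in> carrier_mat (dim_col Z) (dim_row Z) \<and>
     Z * Y * Z = Z \<and> Y * Z * Y = Y \<and>
     mat_adjoint (Z * Y) = Z * Y \<and> mat_adjoint (Y * Z) = Y * Z"

definition moore_penrose_inverse :: "complex mat \<Rightarrow> complex mat" where
  "moore_penrose_inverse Z = (THE Y. is_moore_penrose_inverse Z Y)"

definition is_group_inverse :: "complex mat \<Rightarrow> complex mat \<Rightarrow> bool" where
  "is_group_inverse Z Y \<longleftrightarrow>
     square_mat Z \<and> Y \<in> carrier_mat (dim_row Z) (dim_row Z) \<and>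
     Z * Y * Z = Z \<and> Y * Z * Y = Y \<and> Z * Y = Y * Z"

definition group_inverse :: "complex mat \<Rightarrow> complex mat" where
  "group_inverse Z = (THE Y. is_group_inverse Z Y)"

definition star_DMP :: "complex mat \<Rightarrow> bool" where
  "star_DMP X \<longleftrightarrow> square_mat X \<and>
     (\<exists>r>0. (\<exists>Y. is_moore_penrose_inverse (X ^\<^sub>m r) Y) \<and> (\<exists>Y. is_group_inverse (X ^\<^sub>m r) Y) \<and>
        moore_penrose_inverse (X ^\<^sub>m r) = group_inverse (X ^\<^sub>m r))"

definition nilpotent_mat :: "complex mat \<Rightarrow> bool" where
  "nilpotent_mat X \<longleftrightarrow> square_mat X \<and> (\<exists>k. X ^\<^sub>m k = 0\<^sub>m (dim_row X) (dim_row X))"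

lemma mat_adjoint_index:
  fixes A :: "complex mat"
  assumes "A \<in> carrier_mat m n" "i < n" "j < m"
  shows "mat_adjoint A $$ (i, j) = cnj (A $$ (j, i))"
  using assms by (auto simp: mat_adjoint_def mat_of_rows_def)

lemma mat_adjoint_carrier:
  fixes A :: "complex mat"
  assumes "A \<in> carrier_mat m n"
  shows "mat_adjoint A \<in> carrier_mat n m"
  using assms by (auto simp: mat_adjoint_def mat_of_rows_def)

lemma mat_adjoint_mult:
  fixes A B :: "complex mat"
  assumes A: "A \<in> carrier_mat m n" and B: "B \<in> carrier_mat n p"
  shows "mat_adjoint (A * B) = mat_adjoint B * mat_adjoint A"
proof (rule eq_matI)
  have AB: "A * B \<in> carrier_mat m p" using A B by simp
  note cs = mat_adjoint_carrier[OF A] mat_adjoint_carrier[OF B] mat_adjoint_carrier[OF AB]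
  show "dim_row (mat_adjoint (A * B)) = dim_row (mat_adjoint B * mat_adjoint A)"
    "dim_col (mat_adjoint (A * B)) = dim_col (mat_adjoint B * mat_adjoint A)"
    using cs by auto
  fix i j assume "i < dim_row (mat_adjoint B * mat_adjoint A)"
    "j < dim_col (mat_adjoint B * mat_adjoint A)"
  then have i: "i < p" and j: "j < m" using cs by auto
  have "mat_adjoint (A * B) $$ (i, j) = cnj ((A * B) $$ (j, i))"
    by (rule mat_adjoint_index[OF AB i j])
  also have "\<dots> = (\<Sum>k<n. cnj (A $$ (j, k)) * cnj (B $$ (k, i)))"
    using A B i j by (simp add: scalar_prod_def lessThan_atLeast0)
  also have "\<dots> = (\<Sum>k<n. mat_adjoint B $$ (i, k) * mat_adjoint A $$ (k, j))"
    using mat_adjoint_index[OF A _ j] mat_adjoint_index[OF B i] by (simp add: mult.commute)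
  also have "\<dots> = (mat_adjoint B * mat_adjoint A) $$ (i, j)"
    using cs i j by (simp add: scalar_prod_def lessThan_atLeast0)
  finally show "mat_adjoint (A * B) $$ (i, j) = (mat_adjoint B * mat_adjoint A) $$ (i, j)" .
qed

lemma moore_penrose_inverse_unique:
  assumes Y: "is_moore_penrose_inverse Z Y" and W: "is_moore_penrose_inverse Z W"
  shows "Y = W"
proof -
  define m n where "m = dim_row Z" and "n = dim_col Z"
  have c [simp]: "Z \<in> carrier_mat m n" "Y \<in> carrier_mat n m" "W \<in> carrier_mat n m"
    using Y W by (auto simp: is_moore_penrose_inverse_def m_def n_def)
  note y = Y[unfolded is_moore_penrose_inverse_def] and w = W[unfolded is_moore_penrose_inverse_def]
  have cs: "Z * W \<in> carrier_mat m m" "Z * Y \<in> carrier_mat m m"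
    "Y * Z \<in> carrier_mat n n" "W * Z \<in> carrier_mat n n"
    by (rule mult_carrier_mat[OF c(1,3)] mult_carrier_mat[OF c(1,2)]
      mult_carrier_mat[OF c(2,1)] mult_carrier_mat[OF c(3,1)])+
  have ZZ: "(Z * W) * (Z * Y) = Z * Y" "(Z * Y) * (Z * W) = Z * W"
    using y w assoc_mult_mat[of "Z * W" m m Z n Y m] assoc_mult_mat[of "Z * Y" m m Z n W m] by auto
  have YY: "(Y * Z) * (W * Z) = Y * Z" "(W * Z) * (Y * Z) = W * Z"
    using y w assoc_mult_mat[of Y n m Z n "W * Z" n] assoc_mult_mat[of W n m Z n "Y * Z" n]
      assoc_mult_mat[of Z m n W m Z n] assoc_mult_mat[of Z m n Y m Z n] cs by auto
  have 1: "Z * Y = Z * W"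
    using mat_adjoint_mult[OF cs(1,2)] ZZ y w by simp
  have 2: "Y * Z = W * Z"
    using mat_adjoint_mult[OF cs(3,4)] YY y w by simp
  have "Y = Y * (Z * Y)" using y assoc_mult_mat[of Y n m Z n Y m] by simp
  also have "\<dots> = (Y * Z) * W" unfolding 1 using assoc_mult_mat[of Y n m Z n W m] by simp
  also have "\<dots> = W" unfolding 2 using w by simp
  finally show ?thesis .
qed

lemma drazin_inverse_unique:
  assumes Y: "is_drazin_inverse X Y" and Z: "is_drazin_inverse X Z"
  shows "Y = Z"
proof -
  define n where "n = dim_row X"
  have c: "X \<in> carrier_mat n n" "Y \<in> carrier_mat n n" "Z \<in> carrier_mat n n"
    using Y Z by (auto simp: is_drazin_inverse_def n_def)
  have p: "X ^\<^sub>m k \<in> carrier_mat n n" for k using c by simp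
  have Suc': "X ^\<^sub>m Suc k = X * X ^\<^sub>m k" for k
  proof (induction k)
    case (Suc k)
    then show ?case using assoc_mult_mat[OF c(1) p[of k] c(1)] by simp
  qed (use c in auto)
  have up: "V * X ^\<^sub>m Suc m = X ^\<^sub>m m"
    if "V * X ^\<^sub>m Suc k = X ^\<^sub>m k" "k \<le> m" "V \<in> carrier_mat n n" for V k m
    using that(2)
  proof (induction m rule: dec_induct)
    case (step m)
    have "V * X ^\<^sub>m Suc (Suc m) = (V * X ^\<^sub>m Suc m) * X"
      using assoc_mult_mat[OF that(3) p[of "Suc m"] c(1)] by simp
    then show ?case using step.IH by simp
  qed (use that in auto)
  have comm: "V * X ^\<^sub>m m = X ^\<^sub>m m * V" if "X * V = V * X" "V \<in> carrier_mat n n" for V m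
  proof (induction m)
    case (Suc m)
    have "V * X ^\<^sub>m Suc m = (V * X ^\<^sub>m m) * X"
      using assoc_mult_mat[OF that(2) p[of m] c(1)] by simp
    also have "\<dots> = X ^\<^sub>m m * (V * X)"
      unfolding Suc.IH using assoc_mult_mat[OF p[of m] that(2) c(1)] by simp
    also have "\<dots> = X ^\<^sub>m Suc m * V"
      unfolding that(1)[symmetric] using assoc_mult_mat[OF p[of m] c(1) that(2)] by simp
    finally show ?case .
  qed (use that c in auto)
  have fac: "\<exists>W \<in> carrier_mat n n. X * W = W * X \<and> V = X ^\<^sub>m m * W"
    if V: "X * (V * V) = V" "X * V = V * X" "V \<in> carrier_mat n n" for V m
  proof (induction m)
    case 0
    show ?case using V c by (intro bexI[of _ V]) auto
  next
    case (Suc m)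
    then obtain W where W: "W \<in> carrier_mat n n" "X * W = W * X" "V = X ^\<^sub>m m * W" by blast
    have "V * V = V * (X ^\<^sub>m m * W)" using W(3) by simp
    also have "\<dots> = X ^\<^sub>m m * (V * W)"
      using assoc_mult_mat[OF V(3) p[of m] W(1)] assoc_mult_mat[OF p[of m] V(3) W(1)]
        comm[OF V(2,3)] by simp
    finally have "X * (V * V) = X ^\<^sub>m Suc m * (V * W)"
      unfolding Suc' using assoc_mult_mat[OF c(1) p[of m] mult_carrier_mat[OF V(3) W(1)]] by simp
    moreover have "X * (V * W) = (V * W) * X"
      using assoc_mult_mat[OF c(1) V(3) W(1)] assoc_mult_mat[OF V(3) c(1) W(1)]
        assoc_mult_mat[OF V(3) W(1) c(1)] V(2) W(2) by simp
    ultimately show ?case using V W(1) by (intro bexI[of _ "V * W"]) auto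
  qed
  have y: "X * (Y * Y) = Y" "X * Y = Y * X" and z: "X * (Z * Z) = Z" "X * Z = Z * X"
    using Y Z by (auto simp: is_drazin_inverse_def)
  obtain k l where "Y * X ^\<^sub>m Suc k = X ^\<^sub>m k" "Z * X ^\<^sub>m Suc l = X ^\<^sub>m l"
    using Y Z by (auto simp: is_drazin_inverse_def)
  then obtain m where m: "Y * X ^\<^sub>m Suc m = X ^\<^sub>m m" "Z * X ^\<^sub>m Suc m = X ^\<^sub>m m"
    using up c by (meson max.cobounded1 max.cobounded2)
  obtain W where W: "W \<in> carrier_mat n n" "X * W = W * X" "Y = X ^\<^sub>m m * W"
    using fac[OF y c(2)] by blast
  have "Y * (X * Z) = W * X ^\<^sub>m Suc m * Z"
    unfolding W(3) comm[OF W(2,1), symmetric]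
    using assoc_mult_mat[OF mult_carrier_mat[OF W(1) p[of m]] c(1,3)]
      assoc_mult_mat[OF W(1) p[of m] c(1)] by simp
  also have "\<dots> = W * (Z * X ^\<^sub>m Suc m)"
    unfolding comm[OF z(2) c(3)] by (rule assoc_mult_mat[OF W(1) p c(3)])
  also have "\<dots> = Y" unfolding m(2) W(3) by (rule comm[OF W(2,1)])
  finally have "Y = Y * (X * Z)" ..
  moreover obtain V where V: "V \<in> carrier_mat n n" "Z = X ^\<^sub>m m * V"
    using fac[OF z c(3)] by blast
  have "Y * (X * Z) = Y * (X ^\<^sub>m Suc m * V)"
    unfolding Suc' V(2) using assoc_mult_mat[OF c(1) p[of m] V(1)] by simp
  then have "Y * (X * Z) = Z"
    using assoc_mult_mat[OF c(2) p[of "Suc m"] V(1)] m(1) V(2) by simp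
  ultimately show ?thesis by simp
qed

lemma group_inverse_unique:
  assumes "is_group_inverse Z Y" "is_group_inverse Z W"
  shows "Y = W"
proof -
  have "is_drazin_inverse Z V" if V: "is_group_inverse Z V" for V
  proof -
    define n where "n = dim_row Z"
    have c: "Z \<in> carrier_mat n n" "V \<in> carrier_mat n n"
      and v: "Z * V * Z = Z" "V * Z * V = V" "Z * V = V * Z"
      using V by (auto simp: is_group_inverse_def n_def)
    have "V * Z ^\<^sub>m (1 + 1) = Z ^\<^sub>m 1"
      using c v assoc_mult_mat[OF c(2,1,1)] by simp
    moreover have "Z * (V * V) = V"
      using v assoc_mult_mat[OF c(1,2,2)] by simp
    ultimately show ?thesis using V v(3) unfolding is_drazin_inverse_def is_group_inverse_def by blast
  qed
  then show ?thesis using assms drazin_inverse_unique by blast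
qed

end

theory Submission
  imports Defs "HOL-Algebra.Subrings"
begin

text \<open>
  A complex matrix \<open>X\<close> is *-DMP precisely when its Drazin inverse \<open>X\<^sup>D\<close> makes the projection
  \<open>X X\<^sup>D\<close> Hermitian (\<open>star_DMP_iff\<close>), that is, when the decomposition of the space into the
  invertible and the nilpotent part of \<open>X\<close> is orthogonal.

  Write \<open>M = P + Q\<close> with \<open>P\<close> the block diagonal part and \<open>Q\<close> the block antidiagonal part of \<open>M\<close>.
  The equations \<open>AB = BD\<close> and \<open>DC = CA\<close> say that \<open>P\<close> and \<open>Q\<close> commute. Both are *-DMP: \<open>P\<close> because
  \<open>A\<close> and \<open>D\<close> are, and \<open>Q\<close> because \<open>Q\<^sup>2\<close> is block diagonal with blocks \<open>BC\<close> and \<open>CB\<close>. The square of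
  \<open>P\<^sup>D Q\<close> is block diagonal with blocks \<open>A\<^sup>D B D\<^sup>D C\<close> and \<open>D\<^sup>D C A\<^sup>D B\<close>, so \<open>P\<^sup>D Q\<close> is nilpotent.

  It remains to add \<open>P\<close> and \<open>Q\<close>, which is a purely algebraic matter (\<open>drazin_add_commuting\<close>).
  The projections \<open>e = P P\<^sup>D\<close> and \<open>f = Q Q\<^sup>D\<close> commute, and since \<open>P\<^sup>D Q\<close> is both nilpotent and
  invertible on the range of \<open>e f\<close>, they are orthogonal to each other. On the range of \<open>e\<close>, \<open>P\<close> is
  invertible and \<open>Q\<close> nilpotent; on that of \<open>f\<close> it is the other way round; on that of \<open>1 - e - f\<close>
  both are nilpotent. Hence \<open>P + Q\<close> has a Drazin inverse with projection \<open>e + f\<close>, which is Hermitian.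
  All elements occurring in this argument lie in the bicommutant of \<open>{P, Q}\<close>, so the computation
  takes place in a commutative ring (\<open>drazin_add\<close>).
\<close>

section \<open>Drazin inverses in monoids\<close>

text \<open>
  \<open>drazin_in G x y\<close> means that \<open>y\<close> is the Drazin inverse of \<open>x\<close> in \<open>G\<close>. Only the operations of \<open>G\<close>
  and membership in its carrier enter, so the predicate passes to subrings with the same operations.
  The idempotent \<open>x \<otimes> y\<close> is called the projection of \<open>x\<close> below.
\<close>

definition drazin_in :: "('a, 'm) monoid_scheme \<Rightarrow> 'a \<Rightarrow> 'a \<Rightarrow> bool" where
  "drazin_in G x y \<longleftrightarrow> x \<in> carrier G \<and> y \<in> carrier G \<and> x \<otimes>\<^bsub>G\<^esub> y = y \<otimes>\<^bsub>G\<^esub> x \<and>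
     x \<otimes>\<^bsub>G\<^esub> (y \<otimes>\<^bsub>G\<^esub> y) = y \<and> (\<exists>k::nat. y \<otimes>\<^bsub>G\<^esub> x [^]\<^bsub>G\<^esub> Suc k = x [^]\<^bsub>G\<^esub> k)"

lemma drazin_inD:
  assumes "drazin_in G x y"
  shows "x \<in> carrier G" "y \<in> carrier G" "x \<otimes>\<^bsub>G\<^esub> y = y \<otimes>\<^bsub>G\<^esub> x" "x \<otimes>\<^bsub>G\<^esub> (y \<otimes>\<^bsub>G\<^esub> y) = y"
  using assms by (auto simp: drazin_in_def)

lemma drazin_in_carrier_update:
  assumes "drazin_in G x y" "x \<in> H" "y \<in> H"
  shows "drazin_in (G\<lparr>carrier := H\<rparr>) x y"
  using assms by (auto simp: drazin_in_def nat_pow_def)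

context monoid
begin

lemma drazin_projection_idem:
  assumes "drazin_in G x y"
  shows "(x \<otimes> y) \<otimes> (x \<otimes> y) = x \<otimes> y"
proof -
  note d = drazin_inD[OF assms]
  have "(x \<otimes> y) \<otimes> (x \<otimes> y) = x \<otimes> ((y \<otimes> x) \<otimes> y)"
    using d(1,2) by (simp add: m_assoc)
  also have "\<dots> = x \<otimes> (x \<otimes> (y \<otimes> y))"
    using d(1,2) by (simp add: d(3)[symmetric] m_assoc)
  finally show ?thesis using d(4) by simp
qed

lemma drazin_projection_absorb:
  assumes "drazin_in G x y"
  shows "(x \<otimes> y) \<otimes> y = y" "y \<otimes> (x \<otimes> y) = y"
    "(x \<otimes> y) \<otimes> x = x \<otimes> (x \<otimes> y)"
proof -
  note d = drazin_inD[OF assms]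
  show 1: "(x \<otimes> y) \<otimes> y = y" using d(1,2,4) by (simp add: m_assoc)
  show "y \<otimes> (x \<otimes> y) = y"
    using d(1,2) by (simp add: m_assoc[symmetric] d(3)[symmetric] 1)
  show "(x \<otimes> y) \<otimes> x = x \<otimes> (x \<otimes> y)"
    by (simp only: m_assoc[OF d(1,2,1)] d(3)[symmetric])
qed

lemma drazin_projection_pow:
  assumes "drazin_in G x y"
  shows "x [^] Suc m \<otimes> y [^] Suc m = x \<otimes> y" "y [^] Suc m \<otimes> x [^] Suc m = x \<otimes> y"
proof -
  note d = drazin_inD[OF assms]
  have idem: "(x \<otimes> y) [^] Suc m = x \<otimes> y" for m :: nat
    by (induction m) (use d(1,2) in \<open>simp_all add: drazin_projection_idem[OF assms]\<close>)
  show "x [^] Suc m \<otimes> y [^] Suc m = x \<otimes> y"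
    using idem[of m] pow_mult_distrib[OF d(3) d(1,2), of "Suc m"] by simp
  show "y [^] Suc m \<otimes> x [^] Suc m = x \<otimes> y"
    using idem[of m] pow_mult_distrib[OF d(3)[symmetric] d(2,1), of "Suc m"] d(3) by simp
qed

text \<open>From the index of \<open>x\<close> on, the powers of \<open>x\<close> are fixed by the projection of \<open>x\<close>.\<close>

lemma drazin_index:
  assumes "drazin_in G x y"
  shows "\<exists>k::nat. \<forall>m\<ge>k. (x \<otimes> y) \<otimes> x [^] m = x [^] m \<and> x [^] m \<otimes> (x \<otimes> y) = x [^] m"
proof -
  note d = drazin_inD[OF assms]
  obtain k :: nat where k: "y \<otimes> x [^] Suc k = x [^] k"
    using assms by (auto simp: drazin_in_def)
  have l: "(x \<otimes> y) \<otimes> x [^] m = x [^] m" if "k \<le> m" for m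
  proof -
    have "(y \<otimes> x) \<otimes> x [^] k = x [^] k"
      using k d(1,2) nat_pow_Suc2[OF d(1)] by (simp add: m_assoc)
    then have "((x \<otimes> y) \<otimes> x [^] k) \<otimes> x [^] (m - k) = x [^] k \<otimes> x [^] (m - k)"
      using d(3) by simp
    then show ?thesis using d(1,2) that by (simp add: m_assoc nat_pow_mult)
  qed
  have c: "x [^] m \<otimes> (x \<otimes> y) = (x \<otimes> y) \<otimes> x [^] m" for m :: nat
  proof (induction m)
    case (Suc m)
    have "x [^] Suc m \<otimes> (x \<otimes> y) = x [^] m \<otimes> (x \<otimes> y) \<otimes> x"
      using d(1,2) by (simp add: m_assoc drazin_projection_absorb(3)[OF assms, unfolded m_assoc[OF d(1,2,1)]])
    then show ?case using d(1,2) by (simp add: Suc.IH m_assoc)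
  qed (use d(1,2) in simp)
  show ?thesis using l c by (intro exI[of _ k]) auto
qed

lemma drazin_index_pow:
  assumes "drazin_in G x y"
  shows "\<exists>k::nat. \<forall>m\<ge>k. y \<otimes> x [^] Suc m = x [^] m"
proof -
  note d = drazin_inD[OF assms]
  have "y \<otimes> x [^] Suc m = (x \<otimes> y) \<otimes> x [^] m" for m :: nat
    unfolding d(3) nat_pow_Suc2[OF d(1)] using d(1,2) by (simp add: m_assoc)
  then show ?thesis using drazin_index[OF assms] by auto
qed

text \<open>
  Beyond the index, the powers of \<open>x\<close> and \<open>y\<close> are generalised inverses of each other. By
  \<open>drazin_projection_pow\<close> both products equal \<open>x \<otimes> y\<close>, so this is a group inverse.
\<close>

lemma drazin_power_reflexive:
  assumes "drazin_in G x y"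
  shows "\<exists>k::nat. x [^] Suc k \<otimes> y [^] Suc k \<otimes> x [^] Suc k = x [^] Suc k \<and>
    y [^] Suc k \<otimes> x [^] Suc k \<otimes> y [^] Suc k = y [^] Suc k"
proof -
  note d = drazin_inD[OF assms]
  obtain k :: nat where k: "(x \<otimes> y) \<otimes> x [^] Suc k = x [^] Suc k"
    using drazin_index[OF assms] le_SucI by blast
  have "(x \<otimes> y) \<otimes> y [^] Suc k = y [^] Suc k"
    unfolding nat_pow_Suc2[OF d(2)]
    using drazin_projection_absorb(1)[OF assms] d(1,2) by (simp add: m_assoc[symmetric])
  then show ?thesis
    using k unfolding drazin_projection_pow[OF assms, symmetric, of k]
    by (metis drazin_projection_pow[OF assms])
qed

lemma nat_pow_commute:
  assumes "x \<in> carrier G" "c \<in> carrier G" "c \<otimes> x = x \<otimes> c"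
  shows "c \<otimes> x [^] (m::nat) = x [^] m \<otimes> c"
proof (induction m)
  case (Suc m)
  have "c \<otimes> x [^] Suc m = (x [^] m \<otimes> c) \<otimes> x"
    using assms(1,2) by (simp add: m_assoc Suc.IH[symmetric])
  then show ?case using assms by (simp add: m_assoc)
qed (use assms in simp)

text \<open>
  Whatever commutes with \<open>x\<close> commutes with its Drazin inverse. The projection \<open>e\<close> is a product of
  high powers of \<open>x\<close> and \<open>y\<close>, which gives \<open>c e = e c e = e c\<close>; the claim follows from \<open>y = e y = y e\<close>.
\<close>

lemma drazin_commute:
  assumes "drazin_in G x y" and c: "c \<in> carrier G" "c \<otimes> x = x \<otimes> c"
  shows "c \<otimes> y = y \<otimes> c"
proof -
  note d = drazin_inD[OF assms(1)]
  define e where "e = x \<otimes> y"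
  have e: "e \<in> carrier G" using d by (simp add: e_def)
  obtain k :: nat where k: "\<And>m. k \<le> m \<Longrightarrow> e \<otimes> x [^] m = x [^] m"
      "\<And>m. k \<le> m \<Longrightarrow> x [^] m \<otimes> e = x [^] m"
    using drazin_index[OF assms(1), folded e_def] by blast
  have ex: "x [^] Suc k \<otimes> y [^] Suc k = e" "y [^] Suc k \<otimes> x [^] Suc k = e"
    unfolding e_def by (rule drazin_projection_pow[OF assms(1)])+
  have cx: "c \<otimes> x [^] Suc k = x [^] Suc k \<otimes> c" by (rule nat_pow_commute[OF d(1) c])
  define X where "X = x [^] Suc k"
  define Y where "Y = y [^] Suc k"
  have XY: "X \<in> carrier G" "Y \<in> carrier G" using d by (simp_all add: X_def Y_def del: nat_pow_Suc)
  have f: "X \<otimes> Y = e" "Y \<otimes> X = e" "c \<otimes> X = X \<otimes> c" "e \<otimes> X = X" "X \<otimes> e = X"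
    using ex cx k[of "Suc k"] by (simp_all add: X_def Y_def del: nat_pow_Suc)
  have "c \<otimes> e = (X \<otimes> c) \<otimes> Y" using XY c by (simp add: f(1)[symmetric] m_assoc[symmetric] f(3))
  also have "\<dots> = e \<otimes> ((X \<otimes> c) \<otimes> Y)" using XY c e f(4) by (simp add: m_assoc[symmetric])
  also have "(X \<otimes> c) \<otimes> Y = c \<otimes> e" using XY c by (simp add: f(1)[symmetric] m_assoc[symmetric] f(3))
  finally have 1: "c \<otimes> e = e \<otimes> (c \<otimes> e)" .
  have "e \<otimes> c = Y \<otimes> (c \<otimes> X)" using XY c by (simp add: f(2)[symmetric] m_assoc f(3))
  also have "\<dots> = (Y \<otimes> (c \<otimes> X)) \<otimes> e" using XY c e f(5) by (simp add: m_assoc)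
  also have "Y \<otimes> (c \<otimes> X) = e \<otimes> c" using XY c by (simp add: f(2)[symmetric] m_assoc f(3))
  finally have ce: "c \<otimes> e = e \<otimes> c" using 1 e c by (simp add: m_assoc)
  have "c \<otimes> y = (c \<otimes> e) \<otimes> y"
    using drazin_projection_absorb[OF assms(1)] c d(2) e by (simp add: m_assoc e_def)
  also have "\<dots> = (y \<otimes> x) \<otimes> c \<otimes> y"
    unfolding ce by (simp only: e_def d(3))
  also have "\<dots> = y \<otimes> (x \<otimes> c) \<otimes> y" using d(1,2) c by (simp add: m_assoc)
  also have "\<dots> = y \<otimes> (c \<otimes> e)" using d(1,2) c by (simp add: c(2)[symmetric] m_assoc e_def)
  also have "\<dots> = y \<otimes> c"
    using drazin_projection_absorb(2)[OF assms(1), folded e_def] d(2) c e by (simp add: ce m_assoc[symmetric])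
  finally show ?thesis .
qed

text \<open>A Drazin inverse of a positive power of \<open>x\<close> yields one of \<open>x\<close> with the same projection.\<close>

lemma drazin_of_power:
  assumes x: "x \<in> carrier G" and d: "drazin_in G (x [^] Suc r) y"
  shows "drazin_in G x (x [^] r \<otimes> y)" "x \<otimes> (x [^] r \<otimes> y) = x [^] Suc r \<otimes> y"
proof -
  note D = drazin_inD[OF d]
  have y: "y \<in> carrier G" by (rule D(2))
  have xy: "x \<otimes> y = y \<otimes> x"
    by (rule drazin_commute[OF d x]) (metis nat_pow_Suc nat_pow_Suc2 x)
  have xry: "x [^] r \<otimes> y = y \<otimes> x [^] r"
    using nat_pow_commute[OF x y] xy by simp
  show e: "x \<otimes> (x [^] r \<otimes> y) = x [^] Suc r \<otimes> y"
    using x y by (simp only: nat_pow_Suc2 m_assoc nat_pow_closed)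
  have "x \<otimes> (x [^] r \<otimes> y \<otimes> (x [^] r \<otimes> y)) = (x \<otimes> (x [^] r \<otimes> y)) \<otimes> (x [^] r \<otimes> y)"
    using x y by (simp add: m_assoc)
  also have "\<dots> = (x [^] Suc r \<otimes> y) \<otimes> (y \<otimes> x [^] r)" by (simp only: e) (simp only: xry)
  also have "\<dots> = (x [^] Suc r \<otimes> (y \<otimes> y)) \<otimes> x [^] r"
    using x y by (simp add: m_assoc)
  also have "\<dots> = x [^] r \<otimes> y" using D(4) xry by simp
  finally have 2: "x \<otimes> (x [^] r \<otimes> y \<otimes> (x [^] r \<otimes> y)) = x [^] r \<otimes> y" .
  obtain k :: nat where k: "y \<otimes> (x [^] Suc r) [^] Suc k = (x [^] Suc r) [^] k"
    using d by (auto simp: drazin_in_def)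
  have "(x [^] r \<otimes> y) \<otimes> x [^] Suc (Suc r * k) = y \<otimes> (x [^] r \<otimes> x [^] Suc (Suc r * k))"
    using x y by (simp add: xry m_assoc del: nat_pow_Suc)
  also have "x [^] r \<otimes> x [^] Suc (Suc r * k) = (x [^] Suc r) [^] Suc k"
  proof -
    have "r + Suc (Suc r * k) = Suc r * Suc k" by simp
    then show ?thesis by (simp only: nat_pow_mult[OF x] nat_pow_pow[OF x])
  qed
  also have "y \<otimes> (x [^] Suc r) [^] Suc k = x [^] (Suc r * k)" unfolding k by (rule nat_pow_pow[OF x])
  finally have 3: "(x [^] r \<otimes> y) \<otimes> x [^] Suc (Suc r * k) = x [^] (Suc r * k)" .
  have 4: "x \<otimes> (x [^] r \<otimes> y) = (x [^] r \<otimes> y) \<otimes> x"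
    unfolding e using x y by (simp add: m_assoc xy)
  show "drazin_in G x (x [^] r \<otimes> y)"
    unfolding drazin_in_def using x y 2 3 4 by blast
qed

end

section \<open>Nilpotent products and commutants in rings\<close>

context ring
begin

lemma nilpotent_swap:
  assumes xy: "x \<in> carrier R" "y \<in> carrier R" and "(x \<otimes> y) [^] (k::nat) = \<zero>"
  shows "(y \<otimes> x) [^] Suc k = \<zero>"
proof -
  have "(y \<otimes> x) [^] Suc k = y \<otimes> (x \<otimes> y) [^] k \<otimes> x" for k :: nat
  proof (induction k)
    case (Suc k)
    have "(y \<otimes> x) [^] Suc (Suc k) = (y \<otimes> x) [^] Suc k \<otimes> (y \<otimes> x)" by simp
    then show ?case unfolding Suc.IH using xy by (simp add: m_assoc)
  qed (use xy in simp)
  then show ?thesis using assms by simp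
qed

text \<open>The set of ring elements that commute with every element of \<open>S\<close>.\<close>

definition centralizer :: "'a set \<Rightarrow> 'a set" where
  "centralizer S = {x \<in> carrier R. \<forall>s\<in>S. x \<otimes> s = s \<otimes> x}"

lemma subring_centralizer:
  assumes "S \<subseteq> carrier R"
  shows "subring (centralizer S) R"
proof (rule subringI)
  show "\<And>h1 h2. \<lbrakk>h1 \<in> centralizer S; h2 \<in> centralizer S\<rbrakk> \<Longrightarrow> h1 \<otimes> h2 \<in> centralizer S"
    using assms unfolding centralizer_def by (auto simp: subset_eq) (metis m_assoc)
qed (use assms in \<open>auto simp: centralizer_def l_distr r_distr l_minus r_minus subset_eq\<close>)

lemma cring_bicommutant:
  assumes "S \<subseteq> carrier R" "\<And>s t. s \<in> S \<Longrightarrow> t \<in> S \<Longrightarrow> s \<otimes> t = t \<otimes> s"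
  shows "cring (R\<lparr>carrier := centralizer (centralizer S)\<rparr>)"
proof -
  have sub: "centralizer T \<subseteq> carrier R" for T by (auto simp: centralizer_def)
  have "S \<subseteq> centralizer S" using assms by (auto simp: centralizer_def)
  then have "centralizer (centralizer S) \<subseteq> centralizer S" by (auto simp: centralizer_def)
  then have "subcring (centralizer (centralizer S)) R"
    by (intro subcringI subring_centralizer sub) (auto simp: centralizer_def)
  then show ?thesis using subcring_iff sub by blast
qed

end

section \<open>Sums of commuting elements with Drazin inverses\<close>

context cring
begin

lemma pow_add_mod:
  assumes "x \<in> carrier R" "y \<in> carrier R"
  shows "\<exists>w\<in>carrier R. (x \<oplus> y) [^] (k::nat) = y [^] k \<oplus> x \<otimes> w"
proof (induction k)
  case 0
  show ?case using assms by (intro bexI[of _ \<zero>]) simp_all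
next
  case (Suc k)
  then obtain w where w: "w \<in> carrier R" "(x \<oplus> y) [^] k = y [^] k \<oplus> x \<otimes> w" by blast
  have p: "y [^] k \<in> carrier R" using assms by simp
  have "(x \<oplus> y) [^] Suc k = (y [^] k \<otimes> y) \<oplus> x \<otimes> (y [^] k \<oplus> w \<otimes> (x \<oplus> y))"
    unfolding nat_pow_Suc w(2) using assms w(1) p by algebra
  then show ?case using assms w(1) p
    by (intro bexI[of _ "y [^] k \<oplus> w \<otimes> (x \<oplus> y)"]) simp_all
qed

text \<open>
  If \<open>b\<close> is nilpotent on the range of the projection \<open>e\<close> of \<open>a\<close>, then \<open>a \<oplus> b\<close> is invertible there.
  Indeed \<open>a\<^sup>K\<close> and \<open>(-b)\<^sup>K\<close> differ by a multiple of \<open>a \<oplus> b\<close>, and for large \<open>K\<close> the second power vanishes on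
  the range of \<open>e\<close>, where \<open>a\<^sup>K\<close> is invertible.
\<close>

lemma factor_projection:
  assumes d: "drazin_in R a a'" and b: "b \<in> carrier R" and nil: "b [^] (k::nat) \<otimes> (a \<otimes> a') = \<zero>"
  shows "\<exists>w\<in>carrier R. (a \<oplus> b) \<otimes> w = a \<otimes> a'"
proof -
  note D = drazin_inD[OF d]
  define e where "e = a \<otimes> a'"
  define K where "K = Suc k"
  have e: "e \<in> carrier R" "e \<otimes> e = e" using D drazin_projection_idem[OF d] by (simp_all add: e_def)
  have nilK: "(\<ominus> b) [^] K \<otimes> e = \<zero>"
  proof -
    have "(\<ominus> b) [^] K = (\<ominus> \<one>) [^] K \<otimes> b [^] K"
      using nat_pow_distrib[of "\<ominus> \<one>" b K] b by (simp add: l_minus)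
    moreover have "b [^] K \<otimes> e = b \<otimes> (b [^] k \<otimes> e)"
      using b e by (simp add: K_def m_ac)
    ultimately show ?thesis using b e nil by (simp add: e_def[symmetric] m_assoc)
  qed
  obtain v where v: "v \<in> carrier R" "((a \<oplus> b) \<oplus> (\<ominus> b)) [^] K = (\<ominus> b) [^] K \<oplus> (a \<oplus> b) \<otimes> v"
    using pow_add_mod[of "a \<oplus> b" "\<ominus> b" K] D b by auto
  have "(a \<oplus> b) \<oplus> (\<ominus> b) = a" using D(1) b by algebra
  then have aK: "a [^] K = (\<ominus> b) [^] K \<oplus> (a \<oplus> b) \<otimes> v" using v(2) by simp
  have "e = a [^] K \<otimes> a' [^] K \<otimes> e"
    using drazin_projection_pow(1)[OF d, of k] e by (simp add: K_def e_def)
  also have "\<dots> = (((\<ominus> b) [^] K \<otimes> e) \<oplus> (a \<oplus> b) \<otimes> v \<otimes> e) \<otimes> a' [^] K"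
    unfolding aK using D(1,2) b v(1) e(1) by (simp add: l_distr r_distr m_ac)
  also have "\<dots> = (a \<oplus> b) \<otimes> (v \<otimes> e \<otimes> a' [^] K)"
    unfolding nilK using D(1,2) b v(1) e(1) by (simp add: m_assoc)
  finally show ?thesis using v(1) e(1) D(2)
    by (intro bexI[of _ "v \<otimes> e \<otimes> a' [^] K"]) (simp_all add: e_def)
qed

lemma drazin_add:
  assumes a: "drazin_in R a a'" and b: "drazin_in R b b'" and nil: "(a' \<otimes> b) [^] (m::nat) = \<zero>"
  shows "\<exists>w. drazin_in R (a \<oplus> b) w \<and> (a \<oplus> b) \<otimes> w = a \<otimes> a' \<oplus> b \<otimes> b'"
proof -
  note A = drazin_inD[OF a] and B = drazin_inD[OF b]
  define e f g h c where defs: "e = a \<otimes> a'" "f = b \<otimes> b'" "g = e \<oplus> f" "h = \<one> \<ominus> g" "c = a \<oplus> b"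
  have cl: "e \<in> carrier R" "f \<in> carrier R" "g \<in> carrier R" "h \<in> carrier R" "c \<in> carrier R"
    using A(1,2) B(1,2) by (simp_all add: defs)
  have idem: "e \<otimes> e = e" "f \<otimes> f = f"
    unfolding defs by (rule drazin_projection_idem[OF a] drazin_projection_idem[OF b])+
  \<comment> \<open>The projection \<open>e \<otimes> f\<close> contains a vanishing power of \<open>a' \<otimes> b\<close> as a factor.\<close>
  have ef: "e \<otimes> f = \<zero>"
  proof -
    have "e \<otimes> f = (a [^] Suc m \<otimes> a' [^] Suc m) \<otimes> (b [^] Suc m \<otimes> b' [^] Suc m)"
      unfolding defs drazin_projection_pow(1)[OF a] drazin_projection_pow(1)[OF b] ..
    also have "\<dots> = (a' \<otimes> b) [^] Suc m \<otimes> (a [^] Suc m \<otimes> b' [^] Suc m)"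
      using A(1,2) B(1,2) by (simp add: nat_pow_distrib m_ac del: nat_pow_Suc)
    also have "\<dots> = \<zero>" using A(1,2) B(1,2) nil by simp
    finally show ?thesis .
  qed
  obtain k1 :: nat where k1: "\<And>m. k1 \<le> m \<Longrightarrow> e \<otimes> a [^] m = a [^] m"
    using drazin_index[OF a, folded defs(1)] by blast
  obtain k2 :: nat where k2: "\<And>m. k2 \<le> m \<Longrightarrow> f \<otimes> b [^] m = b [^] m"
    using drazin_index[OF b, folded defs(2)] by blast
  define k where "k = max k1 k2"
  define ak bk where "ak = a [^] k" and "bk = b [^] k"
  have pc: "ak \<in> carrier R" "bk \<in> carrier R" using A B by (simp_all add: ak_def bk_def)
  have ea: "e \<otimes> ak = ak" and fb: "f \<otimes> bk = bk"
    using k1 k2 by (simp_all add: k_def ak_def bk_def)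
  have be: "bk \<otimes> e = \<zero>"
  proof -
    have "bk \<otimes> e = (f \<otimes> bk) \<otimes> e" by (simp add: fb)
    also have "\<dots> = bk \<otimes> (e \<otimes> f)" using cl pc by (simp add: m_ac)
    finally show ?thesis using ef pc by simp
  qed
  have af: "ak \<otimes> f = \<zero>"
  proof -
    have "ak \<otimes> f = (e \<otimes> ak) \<otimes> f" by (simp add: ea)
    also have "\<dots> = ak \<otimes> (e \<otimes> f)" using cl pc by (simp add: m_ac)
    finally show ?thesis using ef pc by simp
  qed
  obtain w1 where w1: "w1 \<in> carrier R" "c \<otimes> w1 = e"
    using factor_projection[OF a B(1), of k] be by (auto simp: defs bk_def)
  obtain w2 where w2: "w2 \<in> carrier R" "c \<otimes> w2 = f"
    using factor_projection[OF b A(1), of k] af A(1) B(1) by (auto simp: defs ak_def a_comm)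
  have gg: "g \<otimes> g = g"
  proof -
    have "g \<otimes> g = e \<otimes> e \<oplus> f \<otimes> f \<oplus> (e \<otimes> f \<oplus> e \<otimes> f)"
      unfolding defs(3) using cl by algebra
    then show ?thesis using idem ef cl by (simp add: defs(3))
  qed
  \<comment> \<open>The factor \<open>g\<close> makes \<open>w\<close> vanish on the nilpotent part, as a Drazin inverse must.\<close>
  define w where "w = (w1 \<oplus> w2) \<otimes> g"
  have w: "w \<in> carrier R" using w1 w2 cl by (simp add: w_def)
  have cw: "c \<otimes> w = g"
  proof -
    have "c \<otimes> w = (c \<otimes> w1 \<oplus> c \<otimes> w2) \<otimes> g"
      unfolding w_def using w1(1) w2(1) cl by (simp add: r_distr m_assoc[symmetric])
    then show ?thesis by (simp add: w1 w2 defs(3)[symmetric] gg)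
  qed
  have gw: "g \<otimes> w = w"
  proof -
    have "g \<otimes> w = (w1 \<oplus> w2) \<otimes> (g \<otimes> g)"
      unfolding w_def using w1(1) w2(1) cl by (simp add: m_ac)
    then show ?thesis by (simp add: gg w_def)
  qed
  have ah: "ak \<otimes> h = \<zero>"
  proof -
    have "ak \<otimes> h = ak \<ominus> e \<otimes> ak \<ominus> ak \<otimes> f"
      unfolding defs(3,4) using cl pc by algebra
    then show ?thesis using ea af pc by (simp add: r_right_minus_eq a_minus_def r_neg)
  qed
  have bh: "bk \<otimes> h = \<zero>"
  proof -
    have "bk \<otimes> h = bk \<ominus> f \<otimes> bk \<ominus> bk \<otimes> e"
      unfolding defs(3,4) using cl pc by algebra
    then show ?thesis using fb be pc by (simp add: a_minus_def r_neg)
  qed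
  have hh: "h \<otimes> h = h"
  proof -
    have "h \<otimes> h = \<one> \<ominus> g \<ominus> g \<oplus> g \<otimes> g" unfolding defs(4) using cl by algebra
    also have "\<dots> = h" unfolding gg defs(4) using cl by algebra
    finally show ?thesis .
  qed
  have hpow: "h [^] Suc j = h" for j :: nat
    by (induction j) (use cl hh in simp_all)
  \<comment> \<open>Both \<open>a\<^sup>k\<close> and \<open>b\<^sup>k\<close> are annihilated by \<open>h\<close>. Modulo \<open>a\<close> the power \<open>c\<^sup>k\<close> equals \<open>b\<^sup>k\<close>, so
    \<open>c\<^sup>k h\<close> is a multiple of \<open>a\<close>, and a further power of it is a multiple of \<open>a\<^sup>k h\<close>.\<close>
  obtain u where u: "u \<in> carrier R" "c [^] k = bk \<oplus> a \<otimes> u"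
    using pow_add_mod[OF A(1) B(1), of k] by (auto simp: defs bk_def)
  have "c [^] k \<otimes> h = a \<otimes> u \<otimes> h"
    unfolding u(2) using bh u(1) A(1) pc cl by (simp add: l_distr)
  then have "(c [^] k \<otimes> h) [^] Suc k = ((a \<otimes> u) \<otimes> h) [^] Suc k" by simp
  also have "\<dots> = (ak \<otimes> h) \<otimes> (a \<otimes> u [^] Suc k)"
  proof -
    have "((a \<otimes> u) \<otimes> h) [^] Suc k = (a [^] Suc k \<otimes> u [^] Suc k) \<otimes> h [^] Suc k"
      using A(1) u(1) cl by (simp add: nat_pow_distrib del: nat_pow_Suc Group.nat_pow_Suc)
    then show ?thesis unfolding hpow using A(1) u(1) cl by (simp add: m_ac ak_def)
  qed
  also have "\<dots> = \<zero>" using ah A(1) u(1) by simp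
  finally have "(c [^] k \<otimes> h) [^] Suc k = \<zero>" .
  moreover have "(c [^] k \<otimes> h) [^] Suc k = c [^] (k * Suc k) \<otimes> h [^] Suc k"
    using cl by (simp add: nat_pow_distrib nat_pow_pow del: nat_pow_Suc Group.nat_pow_Suc)
  ultimately have nilh: "c [^] (k * Suc k) \<otimes> h = \<zero>" unfolding hpow by simp
  define K where "K = k * Suc k"
  have "w \<otimes> c [^] Suc K = c [^] K"
  proof -
    have cK: "c [^] K \<in> carrier R" using cl by simp
    have "w \<otimes> c [^] Suc K = c [^] K \<otimes> (c \<otimes> w)" using cl w by (simp add: m_ac)
    also have "\<dots> = c [^] K \<ominus> c [^] K \<otimes> h" unfolding cw defs(4) using cl(3) cK by algebra
    also have "\<dots> = c [^] K" using nilh cl by (simp add: K_def a_minus_def)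
    finally show ?thesis .
  qed
  moreover have "c \<otimes> (w \<otimes> w) = w" using cw gw w cl by (simp add: m_assoc[symmetric])
  moreover have "c \<otimes> w = w \<otimes> c" using w cl by (rule_tac m_comm)
  ultimately have "drazin_in R c w" unfolding drazin_in_def using w cl by blast
  then show ?thesis using cw by (auto simp: defs)
qed

end

text \<open>
  The elements \<open>a\<close> and \<open>b\<close> lie in their bicommutant, and so do their Drazin inverses by
  \<open>drazin_commute\<close>.
\<close>

lemma (in ring) drazin_add_commuting:
  assumes a: "drazin_in R a a'" and b: "drazin_in R b b'" and ab: "a \<otimes> b = b \<otimes> a"
    and nil: "(a' \<otimes> b) [^] (m::nat) = \<zero>"
  shows "\<exists>w. drazin_in R (a \<oplus> b) w \<and> (a \<oplus> b) \<otimes> w = a \<otimes> a' \<oplus> b \<otimes> b'"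
proof -
  note A = drazin_inD[OF a] and B = drazin_inD[OF b]
  define H where "H = centralizer (centralizer {a, b})"
  interpret H: cring "R\<lparr>carrier := H\<rparr>"
    unfolding H_def by (rule cring_bicommutant) (use A B ab in auto)
  have "a \<in> H" "b \<in> H" using A(1) B(1) by (auto simp: H_def centralizer_def)
  moreover have "a' \<in> H" "b' \<in> H"
    using A(2) B(2) by (auto simp: H_def centralizer_def drazin_commute[OF a] drazin_commute[OF b])
  ultimately obtain w where "drazin_in (R\<lparr>carrier := H\<rparr>) (a \<oplus> b) w" "(a \<oplus> b) \<otimes> w = a \<otimes> a' \<oplus> b \<otimes> b'"
    using H.drazin_add[OF drazin_in_carrier_update[OF a] drazin_in_carrier_update[OF b], of m] nil
    by (auto simp: nat_pow_def)
  moreover have "H \<subseteq> carrier R" by (auto simp: H_def centralizer_def)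
  ultimately show ?thesis by (auto simp: drazin_in_def nat_pow_def)
qed

section \<open>Matrices that are *-DMP\<close>

abbreviation mat_ring :: "nat \<Rightarrow> complex mat ring" where
  "mat_ring n \<equiv> ring_mat TYPE(complex) n ()"

lemma is_drazin_inverse_iff_drazin_in:
  assumes "X \<in> carrier_mat n n"
  shows "is_drazin_inverse X Y \<longleftrightarrow> drazin_in (mat_ring n) X Y"
  using assms
  by (auto simp: is_drazin_inverse_def drazin_in_def ring_mat_simps
    pow_mat_ring_pow[OF assms, of _ "()", symmetric])

text \<open>
  The group inverse of a power of \<open>X\<close> determines the Drazin inverse of \<open>X\<close>, with the same projection.
  A group inverse is a Moore-Penrose inverse precisely when this projection is Hermitian.
\<close>

lemma star_DMP_iff:
  assumes X: "X \<in> carrier_mat n n"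
  shows "star_DMP X \<longleftrightarrow> (\<exists>Y. is_drazin_inverse X Y \<and> mat_adjoint (X * Y) = X * Y)"
proof
  interpret ring "mat_ring n" by (rule ring_mat)
  note simps = ring_mat_simps pow_mat_ring_pow[OF X, of _ "()", symmetric]
  have Xp: "X ^\<^sub>m r \<in> carrier_mat n n" for r using X by simp
  {
    assume "star_DMP X"
    then obtain r Y Z where r: "r > 0" and Y: "is_moore_penrose_inverse (X ^\<^sub>m r) Y"
      and Z: "is_group_inverse (X ^\<^sub>m r) Z"
      and eq: "moore_penrose_inverse (X ^\<^sub>m r) = group_inverse (X ^\<^sub>m r)"
      by (auto simp: star_DMP_def)
    have "moore_penrose_inverse (X ^\<^sub>m r) = Y"
      unfolding moore_penrose_inverse_def
      by (rule the_equality, rule Y, rule moore_penrose_inverse_unique[OF _ Y])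
    moreover have "group_inverse (X ^\<^sub>m r) = Z"
      unfolding group_inverse_def
      by (rule the_equality, rule Z, rule group_inverse_unique[OF _ Z])
    ultimately have YZ: "Y = Z" using eq by simp
    have Zc: "Z \<in> carrier_mat n n" and z: "X ^\<^sub>m r * Z * X ^\<^sub>m r = X ^\<^sub>m r"
      "Z * X ^\<^sub>m r * Z = Z" "X ^\<^sub>m r * Z = Z * X ^\<^sub>m r"
      using Z Xp[of r] by (auto simp: is_group_inverse_def)
    obtain s where s: "r = Suc s" using r by (cases r) auto
    have "drazin_in (mat_ring n) (X ^\<^sub>m r) Z"
    proof -
      have "X ^\<^sub>m r * (Z * Z) = Z"
        using z assoc_mult_mat[OF Xp[of r] Zc Zc] by simp
      moreover have "Z * (X ^\<^sub>m r) ^\<^sub>m Suc 1 = (X ^\<^sub>m r) ^\<^sub>m 1"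
        using z assoc_mult_mat[OF Zc Xp[of r] Xp[of r]] Xp[of r] by simp
      ultimately show ?thesis
        using Zc Xp[of r] z(3) unfolding drazin_in_def ring_mat_simps
          pow_mat_ring_pow[OF Xp[of r], of _ "()", symmetric] by blast
    qed
    then have "drazin_in (mat_ring n) X (X ^\<^sub>m s * Z) \<and> X * (X ^\<^sub>m s * Z) = X ^\<^sub>m r * Z"
      using drazin_of_power[of X s Z] X unfolding s simps by blast
    then show "\<exists>Y. is_drazin_inverse X Y \<and> mat_adjoint (X * Y) = X * Y"
      using Y unfolding YZ is_drazin_inverse_iff_drazin_in[OF X] is_moore_penrose_inverse_def
      by metis
  next
    assume "\<exists>Y. is_drazin_inverse X Y \<and> mat_adjoint (X * Y) = X * Y"
    then obtain Y where Y: "drazin_in (mat_ring n) X Y" and herm: "mat_adjoint (X * Y) = X * Y"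
      using is_drazin_inverse_iff_drazin_in[OF X] by blast
    have Yc: "Y \<in> carrier_mat n n" using drazin_inD(2)[OF Y] by (simp add: simps)
    note simps = simps pow_mat_ring_pow[OF Yc, of _ "()", symmetric]
    obtain k where k: "X ^\<^sub>m Suc k * Y ^\<^sub>m Suc k * X ^\<^sub>m Suc k = X ^\<^sub>m Suc k"
       "Y ^\<^sub>m Suc k * X ^\<^sub>m Suc k * Y ^\<^sub>m Suc k = Y ^\<^sub>m Suc k"
      using drazin_power_reflexive[OF Y] unfolding simps by blast
    have p: "X ^\<^sub>m Suc k * Y ^\<^sub>m Suc k = X * Y" "Y ^\<^sub>m Suc k * X ^\<^sub>m Suc k = X * Y"
      using drazin_projection_pow[OF Y, of k] unfolding simps by blast+
    have Yp: "Y ^\<^sub>m Suc k \<in> carrier_mat n n" by (rule pow_carrier_mat[OF Yc])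
    note Xk = Xp[of "Suc k"]
    have mp: "is_moore_penrose_inverse (X ^\<^sub>m Suc k) (Y ^\<^sub>m Suc k)"
      using X Xk Yp k p herm unfolding is_moore_penrose_inverse_def by (auto simp del: pow_mat.simps)
    moreover have gi: "is_group_inverse (X ^\<^sub>m Suc k) (Y ^\<^sub>m Suc k)"
      using X Xk Yp k p unfolding is_group_inverse_def by (auto simp del: pow_mat.simps)
    moreover have "moore_penrose_inverse (X ^\<^sub>m Suc k) = Y ^\<^sub>m Suc k"
      unfolding moore_penrose_inverse_def
      by (rule the_equality, rule mp, rule moore_penrose_inverse_unique[OF _ mp])
    moreover have "group_inverse (X ^\<^sub>m Suc k) = Y ^\<^sub>m Suc k"
      unfolding group_inverse_def
      by (rule the_equality, rule gi, rule group_inverse_unique[OF _ gi])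
    ultimately show "star_DMP X"
      unfolding star_DMP_def using X by (metis carrier_matD square_mat.elims(3) zero_less_Suc)
  }
qed

lemma star_DMP_of_square:
  assumes X: "X \<in> carrier_mat n n" and "star_DMP (X * X)"
  shows "star_DMP X"
proof -
  interpret ring "mat_ring n" by (rule ring_mat)
  have XX: "X * X \<in> carrier_mat n n" using X by simp
  obtain Y where Y: "drazin_in (mat_ring n) (X * X) Y" "mat_adjoint (X * X * Y) = X * X * Y"
    using assms(2) star_DMP_iff[OF XX] is_drazin_inverse_iff_drazin_in[OF XX] by blast
  show ?thesis
    using drazin_of_power[of X 1 Y] Y X star_DMP_iff[OF X] is_drazin_inverse_iff_drazin_in[OF X]
    by (auto simp: ring_mat_simps)
qed

lemma star_DMP_add_commuting:
  assumes P: "is_drazin_inverse P P'" "mat_adjoint (P * P') = P * P'"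
    and Q: "star_DMP Q" and c: "P \<in> carrier_mat n n" "Q \<in> carrier_mat n n"
    and comm: "P * Q = Q * P" and nil: "(P' * Q) ^\<^sub>m k = 0\<^sub>m n n"
  shows "star_DMP (P + Q)"
proof -
  interpret ring "mat_ring n" by (rule ring_mat)
  obtain Q' where Q': "is_drazin_inverse Q Q'" "mat_adjoint (Q * Q') = Q * Q'"
    using Q star_DMP_iff[OF c(2)] by blast
  have cc: "P' \<in> carrier_mat n n" "Q' \<in> carrier_mat n n"
    using P(1) Q'(1) c by (auto simp: is_drazin_inverse_def)
  have PQc: "P' * Q \<in> carrier_mat n n" "P + Q \<in> carrier_mat n n" using cc c by auto
  obtain W where W: "is_drazin_inverse (P + Q) W" "(P + Q) * W = P * P' + Q * Q'"
    using drazin_add_commuting[of P P' Q Q' k] P(1) Q'(1) comm nil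
    unfolding is_drazin_inverse_iff_drazin_in[OF c(1)] is_drazin_inverse_iff_drazin_in[OF c(2)]
      is_drazin_inverse_iff_drazin_in[OF PQc(2)] ring_mat_simps
      pow_mat_ring_pow[OF PQc(1), of _ "()", symmetric]
    by blast
  have "mat_adjoint (P * P' + Q * Q') = mat_adjoint (P * P') + mat_adjoint (Q * Q')"
  proof (rule eq_matI)
    have pq: "P * P' \<in> carrier_mat n n" "Q * Q' \<in> carrier_mat n n" "P * P' + Q * Q' \<in> carrier_mat n n"
      using c cc by auto
    note cm = pq pq[THEN mat_adjoint_carrier]
    show "dim_row (mat_adjoint (P * P' + Q * Q')) = dim_row (mat_adjoint (P * P') + mat_adjoint (Q * Q'))"
      "dim_col (mat_adjoint (P * P' + Q * Q')) = dim_col (mat_adjoint (P * P') + mat_adjoint (Q * Q'))"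
      using cm by auto
    fix i j assume "i < dim_row (mat_adjoint (P * P') + mat_adjoint (Q * Q'))"
      "j < dim_col (mat_adjoint (P * P') + mat_adjoint (Q * Q'))"
    then have ij: "i < n" "j < n" using cm by auto
    then show "mat_adjoint (P * P' + Q * Q') $$ (i, j) = (mat_adjoint (P * P') + mat_adjoint (Q * Q')) $$ (i, j)"
      using cm by (simp add: pq[THEN mat_adjoint_index, OF ij] del: index_mult_mat)
  qed
  then show ?thesis
    using W P(2) Q'(2) star_DMP_iff[OF PQc(2)] by auto
qed

section \<open>Block matrices\<close>

lemma is_drazin_inverse_four_block_diag:
  assumes A: "is_drazin_inverse A A'" "A \<in> carrier_mat n n" and D: "is_drazin_inverse D D'" "D \<in> carrier_mat m m"
  shows "is_drazin_inverse (four_block_mat A (0\<^sub>m n m) (0\<^sub>m m n) D) (four_block_mat A' (0\<^sub>m n m) (0\<^sub>m m n) D')"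
proof -
  interpret A: ring "mat_ring n" by (rule ring_mat)
  interpret D: ring "mat_ring m" by (rule ring_mat)
  have c: "A' \<in> carrier_mat n n" "D' \<in> carrier_mat m m"
    using A D by (auto simp: is_drazin_inverse_def)
  obtain k l where k: "\<forall>j\<ge>k. A' * A ^\<^sub>m Suc j = A ^\<^sub>m j" and l: "\<forall>j\<ge>l. D' * D ^\<^sub>m Suc j = D ^\<^sub>m j"
    using A.drazin_index_pow[OF A(1)[unfolded is_drazin_inverse_iff_drazin_in[OF A(2)]]]
      D.drazin_index_pow[OF D(1)[unfolded is_drazin_inverse_iff_drazin_in[OF D(2)]]]
    unfolding ring_mat_simps pow_mat_ring_pow[OF A(2), of _ "()", symmetric]
      pow_mat_ring_pow[OF D(2), of _ "()", symmetric]
    by blast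
  let ?F = "\<lambda>S T. four_block_mat S (0\<^sub>m n m) (0\<^sub>m m n) T"
  have mult: "?F S T * ?F S' T' = ?F (S * S') (T * T')"
    if "S \<in> carrier_mat n n" "S' \<in> carrier_mat n n" "T \<in> carrier_mat m m" "T' \<in> carrier_mat m m"
    for S S' T T' :: "complex mat"
    using that by (subst mult_four_block_mat[of _ n n _ m _ m _ _ n _ m]) auto
  define j where "j = max k l"
  have "?F A' D' * ?F A D ^\<^sub>m (j + 1) = ?F A D ^\<^sub>m j"
    using k l A(2) D(2) c
    by (simp only: pow_four_block_mat[OF A(2) D(2)] mult pow_carrier_mat Suc_eq_plus1[symmetric])
      (simp add: j_def)
  moreover have "?F A D * (?F A' D' * ?F A' D') = ?F A' D'"
    using A D c by (simp add: mult is_drazin_inverse_def)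
  moreover have "?F A D * ?F A' D' = ?F A' D' * ?F A D"
    using A D c by (simp add: mult is_drazin_inverse_def)
  moreover have "?F A D \<in> carrier_mat (n + m) (n + m)" "?F A' D' \<in> carrier_mat (n + m) (n + m)"
    using A D c by auto
  ultimately show ?thesis unfolding is_drazin_inverse_def using A(2) D(2) by auto
qed

lemma mat_adjoint_four_block_diag:
  fixes A D :: "complex mat"
  assumes A: "A \<in> carrier_mat n n" and D: "D \<in> carrier_mat m m"
  shows "mat_adjoint (four_block_mat A (0\<^sub>m n m) (0\<^sub>m m n) D) =
    four_block_mat (mat_adjoint A) (0\<^sub>m n m) (0\<^sub>m m n) (mat_adjoint D)"
proof (rule eq_matI)
  let ?F = "\<lambda>S T. four_block_mat S (0\<^sub>m n m) (0\<^sub>m m n) T"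
  have F: "?F A D \<in> carrier_mat (n + m) (n + m)" using assms by auto
  note c = A D F mat_adjoint_carrier[OF A] mat_adjoint_carrier[OF D] mat_adjoint_carrier[OF F]
  show "dim_row (mat_adjoint (?F A D)) = dim_row (?F (mat_adjoint A) (mat_adjoint D))"
    "dim_col (mat_adjoint (?F A D)) = dim_col (?F (mat_adjoint A) (mat_adjoint D))"
    using c by auto
  fix i j assume "i < dim_row (?F (mat_adjoint A) (mat_adjoint D))"
    "j < dim_col (?F (mat_adjoint A) (mat_adjoint D))"
  then have ij: "i < n + m" "j < n + m" using c by auto
  show "mat_adjoint (?F A D) $$ (i, j) = ?F (mat_adjoint A) (mat_adjoint D) $$ (i, j)"
    unfolding mat_adjoint_index[OF F ij]
    using ij c by (auto simp: mat_adjoint_index[OF A] mat_adjoint_index[OF D])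
qed

lemma hermitian_drazin_four_block_diag:
  assumes "is_drazin_inverse A A'" "mat_adjoint (A * A') = A * A'" "A \<in> carrier_mat n n"
    and "is_drazin_inverse D D'" "mat_adjoint (D * D') = D * D'" "D \<in> carrier_mat m m"
  defines "P \<equiv> four_block_mat A (0\<^sub>m n m) (0\<^sub>m m n) D" and "P' \<equiv> four_block_mat A' (0\<^sub>m n m) (0\<^sub>m m n) D'"
  shows "is_drazin_inverse P P'" "mat_adjoint (P * P') = P * P'"
proof -
  show "is_drazin_inverse P P'"
    unfolding P_def P'_def by (rule is_drazin_inverse_four_block_diag) fact+
  have c: "A' \<in> carrier_mat n n" "D' \<in> carrier_mat m m"
    using assms by (auto simp: is_drazin_inverse_def)
  have "P * P' = four_block_mat (A * A') (0\<^sub>m n m) (0\<^sub>m m n) (D * D')"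
    unfolding P_def P'_def using c assms(3,6)
    by (subst mult_four_block_mat[of _ n n _ m _ m _ _ n _ m]) auto
  then show "mat_adjoint (P * P') = P * P'"
    using c assms(2,3,5,6) by (simp add: mat_adjoint_four_block_diag)
qed

theorem theorem4p4:
  fixes A B C D :: "complex mat" and n :: nat
  assumes "A \<in> carrier_mat n n" "B \<in> carrier_mat n n" "C \<in> carrier_mat n n" "D \<in> carrier_mat n n"
    and "star_DMP A" "star_DMP D" "star_DMP (B * C)" "star_DMP (C * B)"
    and "A * B = B * D"
    and "D * C = C * A"
    and "mat_adjoint B * A = D * mat_adjoint B"
    and "nilpotent_mat (drazin_inverse A * B * drazin_inverse D * C)"
  shows "star_DMP (four_block_mat A B C D)"
proof -
  note c = assms(1-4)
  let ?Z = "0\<^sub>m n n :: complex mat"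
  obtain A' where A': "is_drazin_inverse A A'" "mat_adjoint (A * A') = A * A'"
    using assms(5) star_DMP_iff[OF c(1)] by blast
  obtain D' where D': "is_drazin_inverse D D'" "mat_adjoint (D * D') = D * D'"
    using assms(6) star_DMP_iff[OF c(4)] by blast
  have A'D': "drazin_inverse A = A'" "drazin_inverse D = D'"
    unfolding drazin_inverse_def
    using A'(1) D'(1) by (auto intro!: the_equality intro: drazin_inverse_unique)
  have c': "A' \<in> carrier_mat n n" "D' \<in> carrier_mat n n"
    using A'(1) D'(1) c by (auto simp: is_drazin_inverse_def)
  define P P' Q where "P = four_block_mat A ?Z ?Z D" and "P' = four_block_mat A' ?Z ?Z D'"
    and "Q = four_block_mat ?Z B C ?Z"
  have PQc: "P \<in> carrier_mat (n + n) (n + n)" "P' \<in> carrier_mat (n + n) (n + n)"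
    "Q \<in> carrier_mat (n + n) (n + n)"
    using c c' by (auto simp: P_def P'_def Q_def)
  have P: "is_drazin_inverse P P'" "mat_adjoint (P * P') = P * P'"
    unfolding P_def P'_def
    by (rule hermitian_drazin_four_block_diag[OF A' c(1) D' c(4)])+
  have BC: "B * C \<in> carrier_mat n n" "C * B \<in> carrier_mat n n" using c by auto
  have "Q * Q = four_block_mat (B * C) ?Z ?Z (C * B)"
    unfolding Q_def using c by (subst mult_four_block_mat[of _ n n _ n _ n _ _ n _ n]) auto
  then have "star_DMP (Q * Q)"
    using hermitian_drazin_four_block_diag[OF _ _ BC(1) _ _ BC(2)] assms(7,8) star_DMP_iff[OF BC(1)]
      star_DMP_iff[OF BC(2)] star_DMP_iff[of "Q * Q" "n + n"] PQc(3) by (metis mult_carrier_mat)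
  then have Q: "star_DMP Q" by (rule star_DMP_of_square[OF PQc(3)])
  have PQ: "P * Q = Q * P"
    unfolding P_def Q_def using c assms(9,10)
    by (simp add: mult_four_block_mat[of _ n n _ n _ n _ _ n _ n])
  have "\<exists>k. (P' * Q) ^\<^sub>m k = 0\<^sub>m (n + n) (n + n)"
  proof -
    interpret ring "mat_ring n" by (rule ring_mat)
    define S T where "S = A' * B" and "T = D' * C"
    have ST: "S \<in> carrier_mat n n" "T \<in> carrier_mat n n" using c c' by (auto simp: S_def T_def)
    then have STc: "S * T \<in> carrier_mat n n" "T * S \<in> carrier_mat n n" by auto
    have "nilpotent_mat (S * T)"
      using assms(12) assoc_mult_mat[of "A' * B" n n D' n C n] c c' unfolding A'D' S_def T_def by simp
    then obtain k where "(S * T) ^\<^sub>m k = 0\<^sub>m n n"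
      using ST by (auto simp: nilpotent_mat_def)
    then have k: "(S * T) ^\<^sub>m Suc k = 0\<^sub>m n n" "(T * S) ^\<^sub>m Suc k = 0\<^sub>m n n"
      using nilpotent_swap[of S T k] ST STc
      by (auto simp: ring_mat_simps pow_mat_ring_pow[OF STc(1), of _ "()", symmetric]
        pow_mat_ring_pow[OF STc(2), of _ "()", symmetric])
    have "P' * Q = four_block_mat ?Z S T ?Z"
      unfolding P'_def Q_def S_def T_def using c c'
      by (simp add: mult_four_block_mat[of _ n n _ n _ n _ _ n _ n])
    then have "(P' * Q) * (P' * Q) = four_block_mat (S * T) ?Z ?Z (T * S)"
      using ST by (simp add: mult_four_block_mat[of _ n n _ n _ n _ _ n _ n])
    then have "(P' * Q * (P' * Q)) ^\<^sub>m Suc k = 0\<^sub>m (n + n) (n + n)"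
      using k by (simp only: pow_four_block_mat[OF STc] four_block_zero_mat)
    moreover have "(P' * Q * (P' * Q)) ^\<^sub>m Suc k = (P' * Q) ^\<^sub>m (2 * Suc k)"
    proof -
      interpret N: ring "mat_ring (n + n)" by (rule ring_mat)
      have V: "P' * Q \<in> carrier_mat (n + n) (n + n)" using PQc by auto
      have "P' * Q * (P' * Q) = (P' * Q) ^\<^sub>m 2" using V by (simp add: numeral_2_eq_2)
      moreover have "((P' * Q) ^\<^sub>m 2) ^\<^sub>m Suc k = (P' * Q) ^\<^sub>m (2 * Suc k)"
        using N.nat_pow_pow[of "P' * Q" 2 "Suc k"] V
        unfolding ring_mat_simps pow_mat_ring_pow[OF V, of _ "()", symmetric]
          pow_mat_ring_pow[OF pow_carrier_mat[OF V], of _ _ "()", symmetric] by blast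
      ultimately show ?thesis by simp
    qed
    ultimately show ?thesis by metis
  qed
  then obtain k where "(P' * Q) ^\<^sub>m k = 0\<^sub>m (n + n) (n + n)" ..
  then have "star_DMP (P + Q)"
    by (rule star_DMP_add_commuting[OF P Q PQc(1,3) PQ])
  also have "P + Q = four_block_mat A B C D"
    unfolding P_def Q_def using c by (subst add_four_block_mat[of _ n n _ n _ n]) auto
  finally show ?thesis .
qed

end
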